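(* The $P^{3}_{1}$-set $\{1,2,13\}$ is non-extendible; that is, there is no integer $y\notin\{1,2,13\}$ such that $\{1,2,13\}\cup\{y\}$ is a $P^{3}_{1}$-set.
   Context: A $P^{3}_{1}$-set of size $m$ is a set $S=\{x_{1},\ldots,x_{m}\}$ of distinct positive integers such that $x_{i}x_{j}x_{k}+1$ is the cube of an integer for all $1\leq i<j<k\leq m$. A $P^{3}_{1}$-set $S$ is said to be extendible if there exists an integer $y\notin S$ such that $S\cup\{y\}$ is a $P^{3}_{1}$-set (in particular, all elements of $S\cup\{y\}$ are positive integers); otherwise it is non-extendible. *)

theory Defs
  imports Main
begin

(* The size m of such a set is card S. Since the product is symmetric, ranging over
   pairwise distinct elements is the same as ranging over indices i < j < k. *)
definition P31_set :: "int set \<Rightarrow> bool" where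
  "P31_set S \<longleftrightarrow> finite S \<and> (\<forall>x\<in>S. x > 0) \<and>
     (\<forall>x\<in>S. \<forall>y\<in>S. \<forall>z\<in>S. x \<noteq> y \<and> y \<noteq> z \<and> x \<noteq> z \<longrightarrow>
        (\<exists>w::int. x * y * z + 1 = w ^ 3))"

definition extendible :: "int set \<Rightarrow> bool" where
  "extendible S \<longleftrightarrow> (\<exists>y. y \<notin> S \<and> P31_set (S \<union> {y}))"

end

theory Submission
  imports Defs "HOL-Computational_Algebra.Nth_Powers" "HOL-Library.Discrete_Functions"
begin

text \<open>
  If \<open>w > 0\<close> extends the set, then \<open>26 w + 1 = c^3\<close> and \<open>13 w + 1 = b^3\<close>, so \<open>c^3 + 1 = 2 b^3\<close>.
  By Euler, \<open>x^3 + y^3 = 2 z^3\<close> with \<open>x\<close>, \<open>y\<close> coprime forces \<open>z = 0\<close> or \<open>x = y\<close>,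
  so \<open>b = 0\<close> or \<open>c = 1\<close>, which is impossible.
  Euler's theorem is an infinite descent: with \<open>x = p + q\<close> and \<open>y = p - q\<close> the equation becomes
  \<open>p (p^2 + 3 q^2) = z^3\<close>, so \<open>p^2 + 3 q^2\<close> is, up to a factor 3, a cube, which makes
  \<open>p + q \<surd>-3\<close> (or its quotient by \<open>\<surd>-3\<close>) the cube of some \<open>u + v \<surd>-3\<close>; the resulting
  factorization of \<open>p\<close> gives a smaller solution.
\<close>

section \<open>Coprime factors of a cube\<close>

text \<open>The result for natural numbers applies to the absolute values, and the sign is harmless
  because -1 is a cube. If a factor is 0, coprimality leaves only \<open>a\<close> in {0, 1,
  -1}.\<close>

lemma coprime_mult_eq_cube_int:
  fixes a b c :: int
  assumes "coprime a b" and "a * b = c ^ 3"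
  shows "\<exists>r. a = r ^ 3"
proof (cases "a = 0 \<or> b = 0")
  case True
  then have "a = 0 \<or> a = 1 \<or> a = -1"
    using assms(1) by auto
  then have "a = 0 ^ 3 \<or> a = 1 ^ 3 \<or> a = (-1) ^ 3"
    by auto
  then show ?thesis by blast
next
  case False
  have "nat \<bar>a\<bar> * nat \<bar>b\<bar> = nat \<bar>c\<bar> ^ 3"
    using assms(2) by (metis abs_mult abs_ge_zero nat_mult_distrib nat_power_eq power_abs)
  then have "is_nth_power 3 (nat \<bar>a\<bar> * nat \<bar>b\<bar>)"
    by simp
  moreover have "coprime (nat \<bar>a\<bar>) (nat \<bar>b\<bar>)"
    using assms(1) by (simp add: coprime_int_iff[symmetric])
  ultimately have "is_nth_power 3 (nat \<bar>a\<bar>)"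
    using False by (intro is_nth_power_mult_coprime_natD(1)[of "nat \<bar>a\<bar>" "nat \<bar>b\<bar>"]) auto
  then obtain k where "nat \<bar>a\<bar> = k ^ 3"
    by (elim is_nth_powerE)
  then have "\<bar>a\<bar> = int k ^ 3"
    by (metis abs_ge_zero int_nat_eq of_nat_power)
  then have "a = int k ^ 3 \<or> a = (- int k) ^ 3"
    by auto
  then show ?thesis by blast
qed

lemma coprime_mult3_eq_cube_int:
  fixes a b c d :: int
  assumes "coprime a b" "coprime a c" "coprime b c" and eq: "a * b * c = d ^ 3"
  obtains e f g where "a = e ^ 3" "b = f ^ 3" "c = g ^ 3"
proof -
  have "\<exists>e. a = e ^ 3"
    by (rule coprime_mult_eq_cube_int[of _ "b * c" d]) (use assms in \<open>auto simp: mult_ac\<close>)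
  moreover have "\<exists>e. b = e ^ 3"
    by (rule coprime_mult_eq_cube_int[of _ "a * c" d])
       (use assms in \<open>auto simp: mult_ac coprime_commute\<close>)
  moreover have "\<exists>e. c = e ^ 3"
    by (rule coprime_mult_eq_cube_int[of _ "a * b" d])
       (use assms in \<open>auto simp: mult_ac coprime_commute\<close>)
  ultimately show ?thesis using that by blast
qed

section \<open>Prime divisors and cubes of the form \<open>x^2 + 3 * y^2\<close>\<close>

text \<open>Thue's lemma by pigeonhole: with \<open>N\<close> the integer square root of
  \<open>l\<close>, there are \<open>(N + 1)^2 > l\<close> pairs in
  \<open>{0..N} \<times> {0..N}\<close>, so two have the same residue of
  \<open>q * x - p * y\<close>, and their difference is the wanted pair. The bounds are strict
  because a prime is not a square.\<close>

lemma thue_int: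
  fixes l p q :: int
  assumes "prime l"
  obtains x y where "x \<noteq> 0 \<or> y \<noteq> 0" "x ^ 2 < l" "y ^ 2 < l" "l dvd q * x - p * y"
proof -
  have l: "l > 1" using assms by (simp add: prime_gt_1_int)
  define N where "N = int (floor_sqrt (nat l))"
  have N0: "N \<ge> 0" by (simp add: N_def)
  have "int ((floor_sqrt (nat l)) ^ 2) \<le> int (nat l)"
    by (simp only: of_nat_le_iff floor_sqrt_power2_le)
  then have "N ^ 2 \<le> l" using l by (simp add: N_def)
  have "\<not> prime (N ^ 2)" by (simp add: prime_power_iff)
  then have N2: "N ^ 2 < l"
    using \<open>N ^ 2 \<le> l\<close> assms by (cases "N ^ 2 = l") auto
  have "int (nat l) < int ((Suc (floor_sqrt (nat l))) ^ 2)"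
    by (simp only: of_nat_less_iff Suc_floor_sqrt_power2_gt)
  then have N3: "l < (N + 1) ^ 2" using l by (simp add: N_def add.commute)
  define f where "f = (\<lambda>(x, y). (q * x - p * y) mod l)"
  define A where "A = {0..N} \<times> {0..N}"
  have "f ` A \<subseteq> {0..<l}"
    using l by (auto simp: f_def)
  then have "card (f ` A) \<le> nat l"
    using card_mono[of "{0..<l}" "f ` A"] by simp
  also have "nat l < nat ((N + 1) ^ 2)"
    using N0 N3 l by simp
  also have "\<dots> = card A"
    using N0 by (simp add: A_def card_cartesian_product power2_eq_square nat_mult_distrib add.commute)
  finally have "\<not> inj_on f A"
    by (rule pigeonhole)
  then obtain x y x' y' where xy: "(x, y) \<in> A" "(x', y') \<in> A" "(x, y) \<noteq> (x', y')"
      "f (x, y) = f (x', y')"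
    by (auto simp: inj_on_def)
  have sq: "(a - b) ^ 2 < l" if "a \<in> {0..N}" "b \<in> {0..N}" for a b
  proof -
    have "\<bar>a - b\<bar> \<le> \<bar>N\<bar>" using that by auto
    then show ?thesis using N2 by (meson abs_le_square_iff le_less_trans)
  qed
  show ?thesis
  proof (rule that[of "x - x'" "y - y'"])
    have "l dvd (q * x - p * y) - (q * x' - p * y')"
      using xy(4) by (simp add: f_def mod_eq_dvd_iff)
    then show "l dvd q * (x - x') - p * (y - y')"
      by (simp add: algebra_simps)
  qed (use xy sq in \<open>auto simp: A_def\<close>)
qed

lemma three_dvd_square_int: "(3::int) dvd x ^ 2 \<Longrightarrow> 3 dvd x"
  using prime_dvd_power_int[of 3 x 2] by simp

text \<open>Thue's lemma yields a multiple \<open>l * k\<close> of the required form with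
  \<open>0 < k < 4\<close>; the value 2 is impossible and 3 can be divided out.\<close>

lemma prime_eq_square_plus_three_square:
  fixes l p q :: int
  assumes "prime l" "odd l" and dvd: "l dvd p ^ 2 + 3 * q ^ 2" and q: "\<not> l dvd q"
  obtains m n where "l = m ^ 2 + 3 * n ^ 2"
proof -
  obtain x y where xy: "x \<noteq> 0 \<or> y \<noteq> 0" "x ^ 2 < l" "y ^ 2 < l" "l dvd q * x - p * y"
    using thue_int[OF \<open>prime l\<close>] by metis
  \<comment> \<open>Modulo \<open>l\<close>, both \<open>q * x = p * y\<close> and
    \<open>p^2 = - 3 * q^2\<close> hold; combining them eliminates \<open>p\<close> and leaves a
    multiple of \<open>q^2\<close>, which can be cancelled.\<close>
  have "l dvd (q * x - p * y) * (q * x + p * y) + (p ^ 2 + 3 * q ^ 2) * y ^ 2"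
    by (intro dvd_add[OF dvd_mult2 dvd_mult2] xy(4) dvd)
  also have "\<dots> = q ^ 2 * (x ^ 2 + 3 * y ^ 2)" by algebra
  finally have "l dvd x ^ 2 + 3 * y ^ 2"
    using q \<open>prime l\<close> by (simp add: prime_dvd_mult_iff prime_dvd_power_iff)
  then obtain k where k: "x ^ 2 + 3 * y ^ 2 = l * k" by (elim dvdE)
  have l: "l > 0" using \<open>prime l\<close> by (simp add: prime_gt_0_int)
  have "x ^ 2 + 3 * y ^ 2 > 0"
    using xy(1) by (metis add_nonneg_pos add_pos_nonneg mult_pos_pos zero_le_power2
        zero_less_numeral zero_less_power2 mult_nonneg_nonneg zero_le_numeral)
  then have "k > 0" using k l by (simp add: zero_less_mult_iff)
  have "l * k < l * 4" using k xy(2,3) by simp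
  then have "k < 4" using l by simp
  then consider "k = 1" | "k = 2" | "k = 3" using \<open>k > 0\<close> by linarith
  then show ?thesis
  proof cases
    case 1
    then show ?thesis using k that[of x y] by simp
  next
    \<comment> \<open>An even value of \<open>x^2 + 3 * y^2\<close> is divisible by 4, whereas
      \<open>2 * l\<close> with \<open>l\<close> odd is not.\<close>
    case 2
    then have e: "even (x ^ 2 + 3 * y ^ 2)" using k by simp
    obtain l' where l': "l = 2 * l' + 1" using \<open>odd l\<close> by (elim oddE)
    have "4 dvd x ^ 2 + 3 * y ^ 2"
    proof (cases "even x")
      case True
      then have "even y" using e by simp
      then obtain x' y' where "x = 2 * x'" "y = 2 * y'" using True by (elim evenE)
      then show ?thesis by (simp add: power_mult_distrib)
    next
      case False
      then have "odd y" using e by simp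
      then obtain x' y' where "x = 2 * x' + 1" "y = 2 * y' + 1" using False by (elim oddE)
      then have "x ^ 2 + 3 * y ^ 2 = 4 * (x' ^ 2 + x' + 3 * y' ^ 2 + 3 * y' + 1)" by algebra
      then show ?thesis by simp
    qed
    then obtain j where "x ^ 2 + 3 * y ^ 2 = 4 * j" by (elim dvdE)
    then have "(2 * l' + 1) * 2 = 4 * j" using k 2 l' by simp
    then have False by presburger
    then show ?thesis ..
  next
    case 3
    then have "x ^ 2 = 3 * (l - y ^ 2)" using k by simp
    then have "3 dvd x ^ 2" by (metis dvd_triv_left)
    then have "3 dvd x" by (rule three_dvd_square_int)
    then obtain x' where "x = 3 * x'" by (elim dvdE)
    then have "l = y ^ 2 + 3 * x' ^ 2" using k 3 by (simp add: power_mult_distrib)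
    then show ?thesis using that by blast
  qed
qed

text \<open>The conclusion says that \<open>m + k \<surd>-3\<close> divides \<open>p + q \<surd>-3\<close> in \<open>\<int>[\<surd>-3]\<close>.\<close>

lemma prime_norm_dvd:
  fixes l m n p q :: int
  assumes "prime l" and l: "l = m ^ 2 + 3 * n ^ 2" and dvd: "l dvd p ^ 2 + 3 * q ^ 2"
  obtains k a b where "k = n \<or> k = - n" "p = m * a - 3 * k * b" "q = m * b + k * a"
proof -
  have "l dvd l * q ^ 2 - n ^ 2 * (p ^ 2 + 3 * q ^ 2)"
    using dvd by simp
  also have "\<dots> = (m * q - n * p) * (m * q + n * p)"
    unfolding l by algebra
  finally have "l dvd m * q - n * p \<or> l dvd m * q + n * p"
    using \<open>prime l\<close> by (simp add: prime_dvd_mult_iff)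
  \<comment> \<open>The sign of \<open>k\<close> records which of the two conjugates of norm
    \<open>l\<close> is the divisor.\<close>
  then obtain k where k: "k = n \<or> k = - n" and "l dvd m * q - k * p"
    by (metis diff_minus_eq_add mult_minus_left)
  then obtain b where b: "m * q - k * p = l * b" by (elim dvdE)
  have lk: "l = m ^ 2 + 3 * k ^ 2" using k l by auto
  \<comment> \<open>The quotient is \<open>(p + q \<surd>-3) * (m - k \<surd>-3) / l\<close>. Its
    \<open>\<surd>-3\<close> coordinate is already integral; multiplicativity of the norm then gives
    integrality of the other one.\<close>
  have "(m * p + 3 * k * q) ^ 2 = l * (p ^ 2 + 3 * q ^ 2) - 3 * (m * q - k * p) ^ 2"
    unfolding lk by algebra
  then have "l dvd (m * p + 3 * k * q) ^ 2"
    unfolding b by (simp add: power2_eq_square)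
  then have "l dvd m * p + 3 * k * q"
    using \<open>prime l\<close> prime_dvd_power_int by blast
  then obtain a where a: "m * p + 3 * k * q = l * a" by (elim dvdE)
  have l0: "l \<noteq> 0" using \<open>prime l\<close> by auto
  show ?thesis
  proof (rule that[OF k])
    have "l * p = l * (m * a - 3 * k * b)" using a b lk by algebra
    then show "p = m * a - 3 * k * b" using l0 by simp
    have "l * q = l * (m * b + k * a)" using a b lk by algebra
    then show "q = m * b + k * a" using l0 by simp
  qed
qed

text \<open>
  Once \<open>m + n \<surd>-3\<close> divides \<open>p + q \<surd>-3\<close>, its conjugate cannot divide the quotient, since
  otherwise the prime \<open>l\<close> would divide both \<open>p\<close> and \<open>q\<close>.
\<close>

lemma prime_norm_dvd_again:
  fixes l m n p q a b :: int
  assumes "prime l" and l: "l = m ^ 2 + 3 * n ^ 2"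
    and "coprime p q" and p: "p = m * a - 3 * n * b" and q: "q = m * b + n * a"
    and "l dvd a ^ 2 + 3 * b ^ 2"
  obtains c d where "a = m * c - 3 * n * d" "b = m * d + n * c" "coprime a b"
proof -
  obtain k c d where kcd: "k = n \<or> k = - n" "a = m * c - 3 * k * d" "b = m * d + k * c"
    using prime_norm_dvd[OF assms(1,2,6)] by metis
  have "k = n"
  proof (rule ccontr)
    assume "k \<noteq> n"
    then have "k = - n" using kcd by simp
    then have "p = l * c" "q = l * d"
      unfolding p q kcd(2,3) l by algebra+
    then have "l dvd p" "l dvd q" by simp_all
    then have "is_unit l" using \<open>coprime p q\<close> coprime_common_divisor by blast
    then show False using \<open>prime l\<close> not_prime_unit by blast
  qed
  moreover have "coprime a b"
  proof (rule coprimeI)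
    fix e assume "e dvd a" "e dvd b"
    then have "e dvd p" "e dvd q" unfolding p q by auto
    then show "is_unit e" using \<open>coprime p q\<close> coprime_common_divisor by blast
  qed
  ultimately show ?thesis using kcd that by blast
qed

text \<open>The conclusion says \<open>p + q \<surd>-3 = (u + v \<surd>-3)^3\<close>. Unique
  factorization fails in \<open>\<int>[\<surd>-3]\<close>, so the proof strips primes
  \<open>l\<close> from the odd number \<open>s\<close> by induction: coprimality forces the same
  factor of norm \<open>l\<close> to divide three times, leaving a quotient of norm
  \<open>t^3\<close>.\<close>

lemma square_plus_three_square_eq_cube:
  fixes p q s :: int
  assumes "s > 0" "odd s" "coprime p q" "p ^ 2 + 3 * q ^ 2 = s ^ 3"
  shows "\<exists>u v. p = u ^ 3 - 9 * u * v ^ 2 \<and> q = 3 * u ^ 2 * v - 3 * v ^ 3"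
  using assms
proof (induction "nat s" arbitrary: s p q rule: less_induct)
  case less
  note eq = \<open>p ^ 2 + 3 * q ^ 2 = s ^ 3\<close>
  show ?case
  proof (cases "s = 1")
    case True
    have "q = 0"
    proof (rule ccontr)
      assume "q \<noteq> 0"
      then have "q ^ 2 > 0" by simp
      moreover have "p ^ 2 \<ge> 0" by simp
      moreover have "p ^ 2 + 3 * q ^ 2 = 1" using eq True by simp
      ultimately show False by linarith
    qed
    then have "p ^ 2 = 1" using eq True by simp
    then have "p = 1 \<or> p = -1" by (simp only: power2_eq_1_iff)
    with \<open>q = 0\<close> have "p = p ^ 3 - 9 * p * 0 ^ 2 \<and> q = 3 * p ^ 2 * 0 - 3 * 0 ^ 3"
      by auto
    then show ?thesis by blast
  next
    case False
    then obtain l where l: "prime l" "l dvd s"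
      using \<open>s > 0\<close> prime_divisor_exists[of s] by auto
    then obtain t where t: "s = l * t" by (elim dvdE)
    have l1: "l > 1" using l(1) by (simp add: prime_gt_1_int)
    have t0: "t > 0" using t \<open>s > 0\<close> l1 by (simp add: zero_less_mult_iff)
    have odd: "odd l" "odd t" using t \<open>odd s\<close> by auto
    have N: "p ^ 2 + 3 * q ^ 2 = l * (l * (l * t ^ 3))"
      using eq t by (simp add: power3_eq_cube)
    have "\<not> l dvd q"
    proof
      assume "l dvd q"
      moreover have "l dvd (p ^ 2 + 3 * q ^ 2) - 3 * q ^ 2"
        using N \<open>l dvd q\<close> by (intro dvd_diff) (auto simp: power2_eq_square)
      then have "l dvd p ^ 2" by simp
      then have "l dvd p" using l(1) prime_dvd_power_int by blast
      ultimately have "is_unit l" using \<open>coprime p q\<close> coprime_common_divisor by blast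
      then show False using l(1) not_prime_unit by blast
    qed
    then obtain m n where mn: "l = m ^ 2 + 3 * n ^ 2"
      using prime_eq_square_plus_three_square[OF l(1) odd(1), of p q] N by (metis dvd_triv_left)
    have "l dvd p ^ 2 + 3 * q ^ 2" using N by simp
    then obtain k a b where k: "k = n \<or> k = - n" and p: "p = m * a - 3 * k * b" "q = m * b + k * a"
      using prime_norm_dvd[OF l(1) mn] by metis
    have lk: "l = m ^ 2 + 3 * k ^ 2" using mn k by auto
    \<comment> \<open>Multiplicativity of the norm; it cancels one factor \<open>l\<close> after
      each of the three divisions.\<close>
    have norm: "(m * x - 3 * k * y) ^ 2 + 3 * (m * y + k * x) ^ 2 = l * (x ^ 2 + 3 * y ^ 2)" for x y
      unfolding lk by algebra
    have l0: "l \<noteq> 0" using l1 by simp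
    have Na: "a ^ 2 + 3 * b ^ 2 = l * (l * t ^ 3)"
      using N norm[of a b] l0 unfolding p by simp
    then have "l dvd a ^ 2 + 3 * b ^ 2" by simp
    then obtain a' b' where a: "a = m * a' - 3 * k * b'" "b = m * b' + k * a'" and "coprime a b"
      using prime_norm_dvd_again[OF l(1) lk \<open>coprime p q\<close> p] by metis
    have Na': "a' ^ 2 + 3 * b' ^ 2 = l * t ^ 3"
      using Na norm[of a' b'] l0 unfolding a by simp
    then have "l dvd a' ^ 2 + 3 * b' ^ 2" by simp
    then obtain c d where c: "a' = m * c - 3 * k * d" "b' = m * d + k * c" and "coprime a' b'"
      using prime_norm_dvd_again[OF l(1) lk \<open>coprime a b\<close> a] by metis
    have Nc: "c ^ 2 + 3 * d ^ 2 = t ^ 3"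
      using Na' norm[of c d] l0 unfolding c by simp
    have "coprime c d"
    proof (rule coprimeI)
      fix e assume "e dvd c" "e dvd d"
      then have "e dvd a'" "e dvd b'" unfolding c by auto
      then show "is_unit e" using \<open>coprime a' b'\<close> coprime_common_divisor by blast
    qed
    moreover have "nat t < nat s" using t t0 l1 by simp
    ultimately obtain u v where uv: "c = u ^ 3 - 9 * u * v ^ 2" "d = 3 * u ^ 2 * v - 3 * v ^ 3"
      using less.hyps[of t c d] t0 odd(2) Nc by blast
    \<comment> \<open>These are the coordinates of
      \<open>(m + k \<surd>-3) * (u + v \<surd>-3)\<close>, because
      \<open>p + q \<surd>-3 = (m + k \<surd>-3)^3 * (c + d \<surd>-3)\<close>.\<close>
    define u' v' where "u' = m * u - 3 * k * v" and "v' = m * v + k * u"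
    have "p = u' ^ 3 - 9 * u' * v' ^ 2" "q = 3 * u' ^ 2 * v' - 3 * v' ^ 3"
      unfolding p a c uv u'_def v'_def by algebra+
    then show ?thesis by blast
  qed
qed

section \<open>Euler's descent for \<open>x^3 + y^3 = 2 * z^3\<close>\<close>

lemma coprime_mult_add_right_iff:
  fixes a b k :: int
  shows "coprime a (k * a + b) \<longleftrightarrow> coprime a b"
  by (simp only: coprime_iff_gcd_eq_1 gcd_add_mult)

lemma coprime_add_diff_int:
  fixes a b :: int
  assumes "coprime a b" "odd (a + b)"
  shows "coprime (a + b) (a - b)"
proof (rule coprimeI)
  fix e assume e: "e dvd a + b" "e dvd a - b"
  then have "e dvd (a + b) + (a - b)" "e dvd (a + b) - (a - b)"
    by (metis dvd_add, metis dvd_diff)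
  then have "e dvd 2 * a" "e dvd 2 * b" by simp_all
  moreover have "coprime e 2"
    using assms(2) e(1) by (metis coprime_right_2_iff_odd dvd_trans)
  ultimately have "e dvd a" "e dvd b"
    by (simp_all add: coprime_dvd_mult_right_iff)
  then show "is_unit e" using assms(1) coprime_common_divisor by blast
qed

theorem cubes_sum_eq_twice_cube:
  fixes x y z :: int
  assumes "coprime x y" "x ^ 3 + y ^ 3 = 2 * z ^ 3"
  shows "z = 0 \<or> x = y"
  using assms
proof (induction "nat \<bar>z\<bar>" arbitrary: x y z rule: less_induct)
  case less
  show ?case
  proof (rule ccontr)
    assume "\<not> (z = 0 \<or> x = y)"
    then have "z \<noteq> 0" "x \<noteq> y" by auto
    have "even (x ^ 3 + y ^ 3)" using less.prems by simp
    then have par: "even x \<longleftrightarrow> even y" by simp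
    then have "even (x + y)" by simp
    then obtain p where p: "x + y = 2 * p" by (elim evenE)
    define q where "q = x - p"
    have x: "x = p + q" and y: "y = p - q" using p by (auto simp: q_def)
    have z: "p * (p ^ 2 + 3 * q ^ 2) = z ^ 3"
    proof -
      have "2 * (p * (p ^ 2 + 3 * q ^ 2)) = 2 * z ^ 3"
        using less.prems(2) unfolding x y by algebra
      then show ?thesis by simp
    qed
    have "p \<noteq> 0" using z \<open>z \<noteq> 0\<close> by auto
    have "q \<noteq> 0" using x y \<open>x \<noteq> y\<close> by auto
    have cop: "coprime p q"
    proof (rule coprimeI)
      fix e assume "e dvd p" "e dvd q"
      then have "e dvd x" "e dvd y" unfolding x y by auto
      then show "is_unit e" using less.prems(1) coprime_common_divisor by blast
    qed
    have "odd x"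
      using par less.prems(1) by (metis coprime_common_divisor odd_one)
    then have pq: "odd (p + q)" using x by simp
    \<comment> \<open>Both cases below end here. As \<open>q \<noteq> 0\<close>, the factor
      \<open>p^2 + 3 * q^2\<close> exceeds 1, so
      \<open>\<bar>e\<bar>^3 \<le> \<bar>p\<bar> < \<bar>z\<bar>^3\<close> and the induction
      hypothesis applies to \<open>(f, g, e)\<close>.\<close>
    have descent: False
      if efg: "e ^ 3 dvd p" "f ^ 3 + g ^ 3 = 2 * e ^ 3" "coprime (f ^ 3) (g ^ 3)" "e \<noteq> 0" "f \<noteq> g"
      for e f g
    proof -
      have "q ^ 2 > 0" using \<open>q \<noteq> 0\<close> by simp
      then have "p ^ 2 + 3 * q ^ 2 > 1" using zero_le_power2[of p] by linarith
      moreover have "\<bar>z\<bar> ^ 3 = \<bar>p\<bar> * (p ^ 2 + 3 * q ^ 2)"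
        using z by (metis abs_mult abs_of_nonneg add_nonneg_nonneg mult_nonneg_nonneg power_abs
            zero_le_numeral zero_le_power2)
      ultimately have "\<bar>p\<bar> < \<bar>z\<bar> ^ 3" using \<open>p \<noteq> 0\<close> by simp
      moreover have "\<bar>e\<bar> ^ 3 \<le> \<bar>p\<bar>"
        using dvd_imp_le_int[OF \<open>p \<noteq> 0\<close> efg(1)] by (simp add: power_abs)
      ultimately have "\<bar>e\<bar> ^ 3 < \<bar>z\<bar> ^ 3" by linarith
      then have "\<bar>e\<bar> < \<bar>z\<bar>" by (rule power_less_imp_less_base) simp
      then have "nat \<bar>e\<bar> < nat \<bar>z\<bar>" by simp
      moreover have "coprime f g" using efg(3) by simp
      ultimately show False using less.hyps[of e f g] efg by blast
    qed
    show False
    proof (cases "3 dvd p")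
      \<comment> \<open>Here \<open>p\<close> and \<open>p^2 + 3 * q^2\<close> are coprime, so each
        is a cube.\<close>
      case False
      then have "coprime p 3"
        using prime_imp_coprime[of "3::int" p] by (simp add: coprime_commute)
      then have "coprime p (3 * q ^ 2)" using cop by simp
      then have "coprime p (p * p + 3 * q ^ 2)"
        using coprime_mult_add_right_iff[of p p "3 * q ^ 2"] by simp
      then have cw: "coprime p (p ^ 2 + 3 * q ^ 2)" by (simp add: power2_eq_square)
      then obtain r where r: "p = r ^ 3"
        using coprime_mult_eq_cube_int z by blast
      obtain s where s: "p ^ 2 + 3 * q ^ 2 = s ^ 3"
        using coprime_mult_eq_cube_int[of "p ^ 2 + 3 * q ^ 2" p z] cw z
        by (auto simp: coprime_commute mult.commute)
      have "p ^ 2 + 3 * q ^ 2 > 0" using \<open>p \<noteq> 0\<close> by (simp add: add_pos_nonneg)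
      then have "s > 0" using s by (simp add: zero_less_power_eq)
      moreover have "odd (p ^ 2 + 3 * q ^ 2)" using pq by simp
      then have "odd s" using s by simp
      ultimately obtain u v where uv: "p = u ^ 3 - 9 * u * v ^ 2" "q = 3 * u ^ 2 * v - 3 * v ^ 3"
        using square_plus_three_square_eq_cube s cop by metis
      \<comment> \<open>The cube \<open>p\<close> splits into three pairwise coprime factors, hence
        three cubes; the last two sum to \<open>2 * u\<close>, which is the smaller instance of the
        equation.\<close>
      have pf: "p = u * (u + 3 * v) * (u - 3 * v)" unfolding uv by algebra
      have qf: "q = v * (3 * u ^ 2 - 3 * v ^ 2)" unfolding uv by algebra
      have "u dvd p" "v dvd q" by (simp_all add: pf qf)
      then have "coprime u v" using cop by (meson coprime_divisors)
      moreover have "coprime u 3" using \<open>coprime p 3\<close> \<open>u dvd p\<close> by (meson coprime_divisors dvd_refl)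
      ultimately have c3: "coprime u (3 * v)" by simp
      have "odd (u + 3 * v)" using pq unfolding uv by auto
      then have c1: "coprime (u + 3 * v) (u - 3 * v)" using c3 coprime_add_diff_int by blast
      have c2: "coprime u (u + 3 * v)"
        using c3 coprime_mult_add_right_iff[of u 1 "3 * v"] by simp
      have c4: "coprime u (u - 3 * v)"
        using c3 coprime_mult_add_right_iff[of u 1 "- (3 * v)"] by simp
      obtain e f g where efg: "u = e ^ 3" "u + 3 * v = f ^ 3" "u - 3 * v = g ^ 3"
        using coprime_mult3_eq_cube_int[OF c2 c4 c1] pf r by metis
      show False
      proof (rule descent)
        show "e ^ 3 dvd p" using \<open>u dvd p\<close> efg by simp
        show "f ^ 3 + g ^ 3 = 2 * e ^ 3" by (simp flip: efg)
        show "coprime (f ^ 3) (g ^ 3)" using c1 by (simp only: efg(2,3))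
        show "e \<noteq> 0" using efg pf \<open>p \<noteq> 0\<close> by auto
        show "f \<noteq> g"
        proof
          assume "f = g"
          then have "u + 3 * v = u - 3 * v" using efg(2,3) by simp
          then have "v = 0" by simp
          then show False using qf \<open>q \<noteq> 0\<close> by simp
        qed
      qed
    next
      \<comment> \<open>Now 3 divides both factors. Regrouping as \<open>9 * t\<close> and
        \<open>q^2 + 3 * t^2\<close> restores coprimality, and \<open>q + t \<surd>-3\<close> (up to
        conjugation, the quotient by \<open>\<surd>-3\<close>) becomes the cube.\<close>
      case True
      then obtain t where t: "p = 3 * t" by (elim dvdE)
      have "coprime q 3" "coprime q t" using cop unfolding t by (simp_all add: coprime_commute)
      then have "coprime t (q ^ 2)" "coprime 3 (q ^ 2)" by (simp_all add: coprime_commute)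
      then have "coprime t (3 * t * t + q ^ 2)" "coprime 3 (t ^ 2 * 3 + q ^ 2)"
        by (simp_all only: coprime_mult_add_right_iff)
      then have "coprime t (q ^ 2 + 3 * t ^ 2)" "coprime 3 (q ^ 2 + 3 * t ^ 2)"
        by (simp_all add: power2_eq_square mult_ac add.commute)
      then have "coprime (3 ^ 2 * t) (q ^ 2 + 3 * t ^ 2)"
        by (simp only: coprime_mult_left_iff coprime_power_left_iff) simp
      then have cw: "coprime (9 * t) (q ^ 2 + 3 * t ^ 2)" by simp
      have z': "(9 * t) * (q ^ 2 + 3 * t ^ 2) = z ^ 3"
        using z unfolding t by algebra
      obtain r where r: "9 * t = r ^ 3"
        using coprime_mult_eq_cube_int cw z' by blast
      obtain s where s: "q ^ 2 + 3 * t ^ 2 = s ^ 3"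
        using coprime_mult_eq_cube_int[of "q ^ 2 + 3 * t ^ 2" "9 * t" z] cw z'
        by (auto simp: coprime_commute mult.commute)
      have "q ^ 2 + 3 * t ^ 2 > 0" using \<open>q \<noteq> 0\<close> by (simp add: add_pos_nonneg)
      then have "s > 0" using s by (simp add: zero_less_power_eq)
      moreover have "odd (q ^ 2 + 3 * t ^ 2)" using pq t by auto
      then have "odd s" using s by simp
      ultimately obtain u v where uv: "q = u ^ 3 - 9 * u * v ^ 2" "t = 3 * u ^ 2 * v - 3 * v ^ 3"
        using square_plus_three_square_eq_cube s \<open>coprime q t\<close> by metis
      have tf: "t = 3 * (v * (u + v) * (u - v))" unfolding uv by algebra
      have qf: "q = u * (u ^ 2 - 9 * v ^ 2)" unfolding uv by algebra
      have "u dvd q" "v dvd t" by (simp_all add: tf qf)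
      then have c3: "coprime u v" using \<open>coprime q t\<close> by (meson coprime_divisors)
      have "odd (u + v)" using pq unfolding t uv by auto
      then have c1: "coprime (u + v) (u - v)" using c3 coprime_add_diff_int by blast
      have c2: "coprime v (u + v)"
        using c3 coprime_mult_add_right_iff[of v 1 u] by (simp add: coprime_commute add.commute)
      have c4: "coprime v (u - v)"
        using c3 coprime_mult_add_right_iff[of v "-1" u] by (simp add: coprime_commute)
      \<comment> \<open>Since \<open>9 * t = 27 * (v * (u + v) * (u - v))\<close>, removing the
        factor 3 from \<open>r\<close> makes this product of three a cube.\<close>
      have "r ^ 3 = 3 * (3 * t)" using r by simp
      then have "3 dvd r ^ 3" by (metis dvd_triv_left)
      then have "3 dvd r" using prime_dvd_power_int[of 3 r 3] by simp
      then obtain r' where "r = 3 * r'" by (elim dvdE)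
      then have "v * (u + v) * (u - v) = r' ^ 3"
        using r tf by (simp add: power_mult_distrib)
      then obtain e f g where efg: "v = e ^ 3" "u + v = f ^ 3" "u - v = g ^ 3"
        using coprime_mult3_eq_cube_int[OF c2 c4 c1] by metis
      show False
      \<comment> \<open>This time the difference \<open>(u + v) - (u - v) = 2 * v\<close> gives the
        equation, so \<open>g\<close> enters negated.\<close>
      proof (rule descent)
        show "e ^ 3 dvd p" using \<open>v dvd t\<close> efg t by simp
        show "f ^ 3 + (- g) ^ 3 = 2 * e ^ 3" by (simp flip: efg)
        show "coprime (f ^ 3) ((- g) ^ 3)" using c1 unfolding efg(2,3) by simp
        show "e \<noteq> 0" using efg t tf \<open>p \<noteq> 0\<close> by auto
        show "f \<noteq> - g"
        proof
          assume "f = - g"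
          then have "u + v = - (u - v)" using efg(2,3) by simp
          then have "u = 0" by simp
          then show False using qf \<open>q \<noteq> 0\<close> by simp
        qed
      qed
    qed
  qed
qed

section \<open>Application to {1, 2, 13}\<close>

theorem corollary1:
  shows "P31_set {1, 2, 13} \<and> \<not> extendible {1, 2, 13}"
proof
  have "\<exists>w::int. 27 = w ^ 3" by (rule exI[of _ 3]) simp
  then show "P31_set {1, 2, 13}" by (auto simp: P31_set_def)
  show "\<not> extendible {1, 2, 13}"
  proof
    assume "extendible {1, 2, 13}"
    then obtain y :: int where "y \<notin> {1, 2, 13}" and P: "P31_set ({1, 2, 13} \<union> {y})"
      by (auto simp: extendible_def)
    then have "y > 0" "\<exists>b. 1 * 13 * y + 1 = b ^ 3" "\<exists>c. 2 * 13 * y + 1 = c ^ 3"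
      unfolding P31_set_def by force+
    then obtain b c where b: "13 * y + 1 = b ^ 3" and c: "26 * y + 1 = c ^ 3" by auto
    have "c ^ 3 + 1 ^ 3 = 2 * b ^ 3" by (simp flip: b c)
    then have "b = 0 \<or> c = 1" using cubes_sum_eq_twice_cube[of c 1 b] by simp
    \<comment> \<open>\<open>b = 0\<close> would give \<open>13 * y = -1\<close>, and
      \<open>c = 1\<close> would give \<open>y = 0\<close>.\<close>
    then show False using b c \<open>y > 0\<close> by auto
  qed
qed

end
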